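(* Let $n>d\geq 1$ be integers, and let $C_1\subseteq S_n$ be the code produced by the general construction described in the context. Write $F=\lfloor n/d\rfloor$, $K=\lceil n/d\rceil$, $r=n\bmod d$. Then \[ |C_1|=\begin{cases} (K+1)^{r}\,\big((F+1)!\big)^{d}\cdot\dfrac{\rho_{K+1}^{\,r}}{2^{d-1}(F+1)} & F>4,\ F \text{ even},\\[2mm] \left(\frac{178}{57}\right)^{r}\cdot 57^{d-1}\cdot 24 & F=4,\\[1mm] \left(\frac{8}{3}\right)^{r}\cdot 3^{d-1}\cdot 2 & F=2,\\[1mm] (K+1)^{r}\,\big((F+1)!\big)^{d}\cdot\dfrac{\rho_{F+1}^{\,(d-1)-r}}{2^{d-1}(F+1)} & F>5,\ F\text{ odd},\\[2mm] \left(\frac{1260}{89}\right)^{r}\cdot 178^{d}\cdot\frac{120}{178} & F=5,\\[1mm] \left(\frac{57}{8}\right)^{r}\cdot 8^{d}\cdot\frac34 & F=3,\\[1mm] 3^{r} & F=1. \end{cases} \]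
   Context: $S_n$ is the group of permutations of $[n]=\{1,\dots,n\}$; vector notation $\sigma=[\sigma(1),\dots,\sigma(n)]$. For $1\leq i<j\leq n$, $t_{i\uparrow j}([a_1,\dots,a_n])=[a_1,\dots,a_{i-1},a_j,a_i,\dots,a_{j-1},a_{j+1},\dots,a_n]$, and $t_{\uparrow j}=t_{1\uparrow j}$. A $G_{\uparrow}(n,M)$ is a sequence $(c_1,\dots,c_M)$ of pairwise distinct elements of $S_n$ such that for every $r\in[M]$, $c_{(r\bmod M)+1}=t_{\uparrow j_r}(c_r)$ for some $1<j_r\leq n$; the $t_{\uparrow j_1},\dots,t_{\uparrow j_M}$ form its (cyclic) transition sequence. A $\mathrm{G}^{\mathrm{aux}}_{\uparrow}(k,M)$ is a $G_\uparrow(k,M)$ code $C$ such that for all $q\in[k-1]$ and $\sigma\in C$, $(q,k)\circ\sigma\notin C$. For each $k\geq 3$ fix a $\mathrm{G}^{\mathrm{aux}}_{\uparrow}(k,\tilde M_k)$ code starting with the identity and with first transition $t_{\uparrow k}$, where $\tilde M_4=8$, $\tilde M_5=57$, $\tilde M_6=178$, $\tilde M_k=\frac{k!}{2}$ for odd $k\ne5$, and $\tilde M_k=\rho_k\frac{k!}{2}=(k-3)\left(\frac{(k-1)!}{2}+2\right)+1$ for even $k>6$ (this defines $\rho_k$, and $\rho_k>\frac{k-3}{k}$); such codes exist. For each $k$ also fix a complete code $G_\uparrow(k,k!)$ (these are known to exist). General construction. For $i\in[d]$ let $\mathcal R_i=\{x\in[n]: x\equiv i \pmod d\}$, so $|\mathcal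 R_i|=\lceil n/d\rceil$ for $1\le i\le (n\bmod d)$ and $|\mathcal R_i|=\lfloor n/d\rfloor$ for $(n\bmod d)<i\le d$. Let $\sigma_0=[\mathcal R_1|\mathcal R_2|\cdots|\mathcal R_d]\in S_n$ be the concatenation of these classes (arbitrary order inside each class) and $p_m=1+\sum_{i=1}^{m-1}|\mathcal R_i|$. All codes start at $\sigma_0$. Case $n\geq 2d$. Base: $C_d$ has transition sequence $t_{p_d\uparrow p_d-1+r_1},\dots,t_{p_d\uparrow p_d-1+r_{L}}$, where $L=|\mathcal R_d|!$ and $t_{\uparrow r_1},\dots,t_{\uparrow r_L}$ is the transition sequence of the complete $G_\uparrow(|\mathcal R_d|,|\mathcal R_d|!)$. Step: for $m=d-1,\dots,1$, let $t_{\uparrow |\mathcal R_m|+1},t_{\uparrow i_2},\dots,t_{\uparrow i_{M}}$, $M=\tilde M_{|\mathcal R_m|+1}$, be the transition sequence of the fixed $\mathrm{G}^{\mathrm{aux}}_{\uparrow}(|\mathcal R_m|+1,\tilde M_{|\mathcal R_m|+1})$; the transition sequence of $C_m$ is that of $C_{m+1}$ with each $t_{p_{m+1}\uparrow j}$ replaced by $t_{p_m\uparrow j}$ followed by $t_{p_m\uparrow p_m-1+i_2},\dots,t_{p_m\uparrow p_m-1+i_M}$ (applied in this order). Case $d<n<2d$. Put $m_0=n\bmod d$. The base is instead $C_{m_0}=\{\sigma_0,\ t_{2m_0-1\uparrow 2m_0+1}\sigma_0,\ t_{2m_0-1\uparrow 2m_0+1}^{\,2}\sigma_0\}$ (generated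 cyclically by $t_{2m_0-1\uparrow 2m_0+1}$ three times), and the same recursion step is used for $m=m_0-1,\dots,1$. *)

theory Defs
  imports Complex_Main "HOL-Combinatorics.Permutations" "HOL-Number_Theory.Cong"
begin

text \<open>
  Elements of \<open>S\<^sub>n\<close> are functions \<open>\<sigma> :: nat \<Rightarrow> nat\<close> with \<open>\<sigma> permutes {1..n}\<close>; the vector notation of
  \<open>\<sigma>\<close> is \<open>[\<sigma> 1, \<dots>, \<sigma> n]\<close>, that is, \<open>map \<sigma> [1..<n+1]\<close>.
\<close>

definition push :: "nat \<Rightarrow> nat \<Rightarrow> (nat \<Rightarrow> nat) \<Rightarrow> (nat \<Rightarrow> nat)" where
  "push i j \<sigma> = (\<lambda>x. if x = i then \<sigma> j else if i < x \<and> x \<le> j then \<sigma> (x - 1) else \<sigma> x)"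

text \<open>\<open>push i j\<close> is \<open>t\<^bsub>i\<up>j\<^esub>\<close>, as the following description in vector notation shows.\<close>

lemma push_vector:
  assumes "1 \<le> i" "i < j" "j \<le> n"
  shows "map (push i j \<sigma>) [1..<n+1] =
    map \<sigma> [1..<i] @ [\<sigma> j] @ map \<sigma> [i..<j] @ map \<sigma> [j+1..<n+1]"
proof -
  have split: "[1..<n+1] = [1..<i] @ [i] @ [i+1..<j+1] @ [j+1..<n+1]"
  proof -
    have "[1..<n+1] = [1..<i] @ [i..<n+1]"
      using assms upt_add_eq_append[of 1 i "n+1-i"] by simp
    moreover have "[i..<n+1] = i # [i+1..<n+1]"
      using assms by (simp add: upt_rec)
    moreover have "[i+1..<n+1] = [i+1..<j+1] @ [j+1..<n+1]"
      using assms upt_add_eq_append[of "i+1" "j+1" "n-j"] by simp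
    ultimately show ?thesis by simp
  qed
  have shift: "map (push i j \<sigma>) [i+1..<j+1] = map \<sigma> [i..<j]"
    by (rule nth_equalityI) (auto simp: push_def nth_append simp del: upt_Suc)
  show ?thesis
    unfolding split map_append shift
    using assms by (auto simp: push_def simp del: upt_Suc)
qed

definition G_up :: "nat \<Rightarrow> nat \<Rightarrow> (nat \<Rightarrow> nat) list \<Rightarrow> bool" where
  "G_up n M C \<longleftrightarrow> length C = M \<and> distinct C \<and> (\<forall>\<sigma> \<in> set C. \<sigma> permutes {1..n}) \<and>
     (\<forall>r<M. \<exists>j. 1 < j \<and> j \<le> n \<and> C ! (Suc r mod M) = push 1 j (C ! r))"

text \<open>The transition \<open>t\<^bsub>\<up>j\<^esub>\<close> is recorded by the number \<open>j\<close>, which is determined by the code:\<close>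

lemma push_1_unique:
  assumes "\<sigma> permutes {1..n}" "push 1 j \<sigma> = push 1 j' \<sigma>"
  shows "j = j'"
  using fun_cong[OF assms(2), of 1] permutes_inj[OF assms(1)] by (auto simp: push_def dest: injD)

definition transition_sequence :: "nat \<Rightarrow> (nat \<Rightarrow> nat) list \<Rightarrow> nat list" where
  "transition_sequence n C =
     map (\<lambda>r. THE j. 1 < j \<and> j \<le> n \<and> C ! (Suc r mod length C) = push 1 j (C ! r)) [0..<length C]"

definition G_aux :: "nat \<Rightarrow> nat \<Rightarrow> (nat \<Rightarrow> nat) list \<Rightarrow> bool" where
  "G_aux k M C \<longleftrightarrow> G_up k M C \<and>
     (\<forall>q \<in> {1..k-1}. \<forall>\<sigma> \<in> set C. transpose q k \<circ> \<sigma> \<notin> set C)"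

text \<open>Only used for \<open>k \<ge> 3\<close>, where the divisions by 2 are exact.\<close>

definition M_tilde :: "nat \<Rightarrow> nat" where
  "M_tilde k =
     (if k = 4 then 8 else if k = 5 then 57 else if k = 6 then 178
      else if odd k then fact k div 2
      else (k - 3) * (fact (k - 1) div 2 + 2) + 1)"

definition \<rho> :: "nat \<Rightarrow> real" where
  "\<rho> k = real (M_tilde k) / (fact k / 2)"

definition residue_class :: "nat \<Rightarrow> nat \<Rightarrow> nat \<Rightarrow> nat set" where
  "residue_class n d i = {x \<in> {1..n}. [x = i] (mod d)}"

definition class_start :: "nat \<Rightarrow> nat \<Rightarrow> nat \<Rightarrow> nat" where
  "class_start n d m = 1 + (\<Sum>i = 1..<m. card (residue_class n d i))"

text \<open>
  \<open>\<sigma> = [R\<^sub>1 | \<dots> | R\<^sub>d]\<close> with an arbitrary order inside each class: the positions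
  \<open>p\<^sub>m, \<dots>, p\<^sub>m + |R\<^sub>m| - 1\<close> hold exactly the elements of \<open>R\<^sub>m\<close>.
\<close>

definition class_concatenation :: "nat \<Rightarrow> nat \<Rightarrow> (nat \<Rightarrow> nat) \<Rightarrow> bool" where
  "class_concatenation n d \<sigma> \<longleftrightarrow> \<sigma> permutes {1..n} \<and>
     (\<forall>m \<in> {1..d}.
        \<sigma> ` {class_start n d m ..< class_start n d m + card (residue_class n d m)}
          = residue_class n d m)"

text \<open>
  In the construction a pair \<open>(i, j)\<close> stands for the transition \<open>t\<^bsub>i\<up>j\<^esub>\<close>. The arguments \<open>A\<close> and \<open>B\<close>
  are the fixed families of auxiliary and of complete codes.
\<close>

definition top_level :: "nat \<Rightarrow> nat \<Rightarrow> nat" where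
  "top_level n d = (if 2 * d \<le> n then d else n mod d)"

definition base_transitions ::
  "nat \<Rightarrow> nat \<Rightarrow> (nat \<Rightarrow> (nat \<Rightarrow> nat) list) \<Rightarrow> (nat \<times> nat) list" where
  "base_transitions n d B =
     (if 2 * d \<le> n then
        (let k = card (residue_class n d d); p = class_start n d d
         in map (\<lambda>r. (p, p - 1 + r)) (transition_sequence k (B k)))
      else
        (let m\<^sub>0 = n mod d in replicate 3 (2 * m\<^sub>0 - 1, 2 * m\<^sub>0 + 1)))"

definition step_transitions ::
  "nat \<Rightarrow> nat \<Rightarrow> (nat \<Rightarrow> (nat \<Rightarrow> nat) list) \<Rightarrow> nat \<Rightarrow> (nat \<times> nat) list \<Rightarrow> (nat \<times> nat) list" where
  "step_transitions n d A m T =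
     (let k = card (residue_class n d m) + 1; p = class_start n d m
      in concat (map (\<lambda>(_, j).
           (p, j) # map (\<lambda>i. (p, p - 1 + i)) (tl (transition_sequence k (A k)))) T))"

text \<open>
  The transition sequence of \<open>C\<^sub>m\<close>: the steps for \<open>top_level n d - 1, \<dots>, m + 1, m\<close> are applied,
  in this order, to the base sequence.
\<close>

definition construction_transitions ::
  "nat \<Rightarrow> nat \<Rightarrow> (nat \<Rightarrow> (nat \<Rightarrow> nat) list) \<Rightarrow> (nat \<Rightarrow> (nat \<Rightarrow> nat) list) \<Rightarrow> nat \<Rightarrow>
   (nat \<times> nat) list" where
  "construction_transitions n d A B m =
     foldr (step_transitions n d A) [m..<top_level n d] (base_transitions n d B)"

text \<open>
  The codewords \<open>c\<^sub>1 = \<sigma>, \<dots>, c\<^sub>L\<close> generated from \<open>\<sigma>\<close> by a sequence of \<open>L\<close> transitions; the last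
  transition leads from \<open>c\<^sub>L\<close> to the next codeword in cyclic order and adds nothing to the set.
\<close>

definition generated_code :: "(nat \<Rightarrow> nat) \<Rightarrow> (nat \<times> nat) list \<Rightarrow> (nat \<Rightarrow> nat) set" where
  "generated_code \<sigma> T = (\<lambda>r. fold (\<lambda>(i, j). push i j) (take r T) \<sigma>) ` {..<length T}"

definition construction_code ::
  "nat \<Rightarrow> nat \<Rightarrow> (nat \<Rightarrow> (nat \<Rightarrow> nat) list) \<Rightarrow> (nat \<Rightarrow> (nat \<Rightarrow> nat) list) \<Rightarrow> (nat \<Rightarrow> nat) \<Rightarrow> nat \<Rightarrow>
   (nat \<Rightarrow> nat) set" where
  "construction_code n d A B \<sigma>\<^sub>0 m = generated_code \<sigma>\<^sub>0 (construction_transitions n d A B m)"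

end

theory Submission
  imports Defs
begin

text \<open>
  A push acts on the positions of a word, so up to left composition with \<open>\<sigma>\<^sub>0\<close> all codewords are
  position permutations. An auxiliary code is a closed cycle starting at the identity with
  \<open>t\<^bsub>\<up>k\<^esub>\<close>, and \<open>t\<^bsub>p\<up>j\<^esub> = t\<^bsub>p\<up>q\<^esub> \<circ> t\<^bsub>q\<up>j\<^esub>\<close> for \<open>p < q < j\<close>; hence the list of transitions replacing
  \<open>t\<^bsub>q\<up>j\<^esub>\<close> again acts as \<open>t\<^bsub>q\<up>j\<^esub>\<close>, and the words visited on the way form a translate of the
  auxiliary code. So \<open>C\<^sub>m\<close> consists of the products \<open>c \<circ> a\<close> with \<open>c\<close> in \<open>C\<^sub>m\<^sub>+\<^sub>1\<close>, moving only positions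
  \<open>\<ge> q = p\<^sub>m\<^sub>+\<^sub>1\<close>, and \<open>a\<close> a shifted auxiliary codeword, moving only positions in \<open>{p\<^sub>m..q}\<close>. As these
  ranges share a single position, all the products are distinct and the sizes multiply.
\<close>

section \<open>Runs of transitions\<close>

abbreviation run :: "(nat \<times> nat) list \<Rightarrow> (nat \<Rightarrow> nat) \<Rightarrow> nat \<Rightarrow> nat" where
  "run \<equiv> fold (\<lambda>(i, j). push i j)"

text \<open>The words after each transition; the start is included only if the run returns to it.\<close>

fun visits :: "(nat \<times> nat) list \<Rightarrow> (nat \<Rightarrow> nat) \<Rightarrow> (nat \<Rightarrow> nat) set" where
  "visits [] \<sigma> = {}"
| "visits ((i, j) # T) \<sigma> = insert (push i j \<sigma>) (visits T (push i j \<sigma>))"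

lemma push_comp: "push i j (\<sigma> \<circ> f) = \<sigma> \<circ> push i j f"
  by (auto simp: push_def fun_eq_iff)

lemma run_comp: "run T (\<sigma> \<circ> f) = \<sigma> \<circ> run T f"
  by (induction T arbitrary: f) (auto simp: push_comp)

lemma visits_comp: "visits T (\<sigma> \<circ> f) = (\<circ>) \<sigma> ` visits T f"
  by (induction T f rule: visits.induct) (simp_all only: visits.simps push_comp image_insert image_empty)

lemma visits_append: "visits (T @ U) \<sigma> = visits T \<sigma> \<union> visits U (run T \<sigma>)"
  by (induction T \<sigma> rule: visits.induct) auto

lemma visits_conv_image: "visits T \<sigma> = (\<lambda>r. run (take (Suc r) T) \<sigma>) ` {..<length T}"
  by (induction T \<sigma> rule: visits.induct) (auto simp: lessThan_Suc_eq_insert_0 image_image)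

lemma generated_code_comp: "generated_code (\<sigma> \<circ> f) T = (\<circ>) \<sigma> ` generated_code f T"
  by (auto simp: generated_code_def run_comp)

lemma image_lessThan_cyclic:
  fixes f :: "nat \<Rightarrow> 'a"
  assumes "f 0 = f n"
  shows "f ` {..<n} = (\<lambda>r. f (Suc r)) ` {..<n}"
proof (cases n)
  case (Suc m)
  have "f ` {..<Suc m} = insert (f 0) (f ` Suc ` {..<m})"
    by (simp only: lessThan_Suc_eq_insert_0 image_insert)
  also have "\<dots> = insert (f (Suc m)) ((\<lambda>r. f (Suc r)) ` {..<m})"
    using assms Suc by (simp only: image_image)
  also have "\<dots> = (\<lambda>r. f (Suc r)) ` {..<Suc m}"
    by (simp only: lessThan_Suc image_insert)
  finally show ?thesis using Suc by simp
qed simp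

text \<open>\<open>generated_code\<close> collects the words before each transition,
  \<open>visits\<close> those after it; on a closed run the index shift loses nothing.
  \<open>visits\<close> is the form that splits over appended lists.\<close>

lemma generated_code_eq_visits:
  assumes "run T \<sigma> = \<sigma>"
  shows "generated_code \<sigma> T = visits T \<sigma>"
  unfolding generated_code_def visits_conv_image
  by (rule image_lessThan_cyclic) (simp add: assms)

lemma push_permutes:
  assumes "i \<le> j" "\<sigma> permutes {i..}"
  shows "push i j \<sigma> permutes {i..}"
proof -
  \<comment> \<open>On the finite interval injectivity suffices; the support is widened to
    \<open>{i..}\<close> afterwards.\<close>
  have "push i j id permutes {i..j}"
  proof (rule inj_imp_permutes)
    show "inj_on (push i j id) {i..j}"
      by (rule inj_onI) (auto simp: push_def split: if_splits)
  qed (use assms in \<open>auto simp: push_def\<close>)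
  then have "push i j id permutes {i..}"
    by (rule permutes_subset) auto
  then have "\<sigma> \<circ> push i j id permutes {i..}"
    using assms(2) by (rule permutes_compose)
  then show ?thesis
    using push_comp[of i j \<sigma> id] by simp
qed

text \<open>The support is left unbounded above: only its lower end \<open>q\<close> serves to tell
  products of words apart.\<close>

lemma visits_permutes:
  assumes "\<And>i j. (i, j) \<in> set T \<Longrightarrow> i = q \<and> q < j" "\<sigma> permutes {q..}" "\<pi> \<in> visits T \<sigma>"
  shows "\<pi> permutes {q..}"
  using assms
proof (induction T \<sigma> rule: visits.induct)
  case (2 i j T \<sigma>)
  have ij: "i = q" "q < j" using "2.prems"(1)[of i j] by auto
  then have "push i j \<sigma> permutes {q..}" using push_permutes "2.prems"(2) by simp
  with 2 show ?case by auto
qed auto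

text \<open>The entry at \<open>j\<close> travels to \<open>p\<close> in two stages, stopping at
  \<open>q\<close>. This lets the head of a replacement block be read as the replaced transition
  followed by the first auxiliary one.\<close>

lemma push_push_push: "p < q \<Longrightarrow> q < j \<Longrightarrow> push p q (push q j \<sigma>) = push p j \<sigma>"
  by (auto simp: push_def fun_eq_iff)

section \<open>Shifted codes\<close>

text \<open>On permutations of \<open>{1..k}\<close> this is conjugation by the translation by
  \<open>s\<close>, fixing everything outside the block \<open>{Suc s..s + k}\<close>.\<close>

definition shift_perm :: "nat \<Rightarrow> (nat \<Rightarrow> nat) \<Rightarrow> nat \<Rightarrow> nat" where
  "shift_perm s f x = (if x \<le> s then x else f (x - s) + s)"

lemma push_shift_perm:
  assumes "0 < j"
  shows "push (Suc s) (s + j) (shift_perm s f) = shift_perm s (push 1 j f)"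
proof
  fix x
  show "push (Suc s) (s + j) (shift_perm s f) x = shift_perm s (push 1 j f) x"
    using assms by (auto simp: push_def shift_perm_def)
qed

lemma shift_perm_id: "shift_perm s id = id"
  by (auto simp: shift_perm_def fun_eq_iff)

lemma shift_perm_permutes:
  assumes "f permutes {1..k}"
  shows "shift_perm s f permutes {Suc s..s + k}"
proof (rule inj_imp_permutes)
  have maps: "f y \<in> {1..k}" if "y \<in> {1..k}" for y
    using permutes_in_image[OF assms] that by blast
  show "inj_on (shift_perm s f) {Suc s..s + k}"
  proof (rule inj_onI)
    fix x y assume *: "x \<in> {Suc s..s + k}" "y \<in> {Suc s..s + k}" "shift_perm s f x = shift_perm s f y"
    then have "f (x - s) = f (y - s)" by (auto simp: shift_perm_def)
    then have "x - s = y - s" using permutes_inj[OF assms] by (simp add: inj_eq)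
    with * show "x = y" by auto
  qed
  show "shift_perm s f x \<in> {Suc s..s + k}" if "x \<in> {Suc s..s + k}" for x
  proof -
    have "x - s \<in> {1..k}" using that by auto
    then have "f (x - s) \<in> {1..k}" by (rule maps)
    with that show ?thesis by (auto simp: shift_perm_def)
  qed
  show "shift_perm s f x = x" if "x \<notin> {Suc s..s + k}" for x
  proof (cases "x \<le> s")
    case False
    then have "x - s \<notin> {1..k}" using that by auto
    then have "f (x - s) = x - s" by (rule permutes_not_in[OF assms])
    with False show ?thesis by (simp add: shift_perm_def)
  qed (simp add: shift_perm_def)
qed simp

lemma inj_on_shift_perm: "inj_on (shift_perm s) {f. f permutes {1..k}}"
proof (intro inj_onI ext)
  fix f g y assume fg: "f \<in> {f. f permutes {1..k}}" "g \<in> {f. f permutes {1..k}}"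
    and eq: "shift_perm s f = shift_perm s g"
  show "f y = g y"
  \<comment> \<open>\<open>shift_perm\<close> forgets the value at 0, but a permutation of
    \<open>{1..k}\<close> fixes 0.\<close>
  proof (cases "y = 0")
    case True
    with fg show ?thesis by (simp add: permutes_def)
  next
    case False
    then show ?thesis using fun_cong[OF eq, of "y + s"] by (simp add: shift_perm_def)
  qed
qed

text \<open>The definite description denotes: a transition exists by \<open>G_up\<close>, and the
  new first entry determines it.\<close>

lemma transition_sequence_nth:
  assumes "G_up k M C" "r < M"
  defines "j \<equiv> transition_sequence k C ! r"
  shows "1 < j" "j \<le> k" "C ! (Suc r mod M) = push 1 j (C ! r)"
proof -
  have len: "length C = M" and perm: "C ! r permutes {1..k}"
    using assms by (auto simp: G_up_def)
  obtain j' where j': "1 < j'" "j' \<le> k" "C ! (Suc r mod M) = push 1 j' (C ! r)"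
    using assms by (auto simp: G_up_def)
  have "j = (THE j. 1 < j \<and> j \<le> k \<and> C ! (Suc r mod M) = push 1 j (C ! r))"
    using assms(2) len by (simp add: j_def transition_sequence_def)
  also have "\<dots> = j'"
    by (rule the_equality) (use j' push_1_unique[OF perm] in auto)
  finally show "1 < j" "j \<le> k" "C ! (Suc r mod M) = push 1 j (C ! r)"
    using j' by auto
qed

lemma length_transition_sequence: "length (transition_sequence k C) = length C"
  by (simp add: transition_sequence_def)

text \<open>With \<open>p = Suc s\<close>, the target \<open>s + i\<close> is
  \<open>p - 1 + i\<close> of the construction, freed from truncated subtraction.\<close>

definition shifted_transitions :: "nat \<Rightarrow> nat \<Rightarrow> (nat \<Rightarrow> nat) list \<Rightarrow> (nat \<times> nat) list" where
  "shifted_transitions s k C = map (\<lambda>i. (Suc s, s + i)) (transition_sequence k C)"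

lemma shifted_transitions_mem:
  assumes "G_up k M C" "(i, j) \<in> set (shifted_transitions s k C)"
  shows "i = Suc s \<and> Suc s < j"
proof -
  obtain r where "r < length C" "i = Suc s" "j = s + transition_sequence k C ! r"
    using assms(2) by (auto simp: shifted_transitions_def in_set_conv_nth length_transition_sequence)
  then show ?thesis
    using transition_sequence_nth(1)[OF assms(1)] assms(1) by (auto simp: G_up_def)
qed

text \<open>Allowing \<open>t = M\<close>, where \<open>t mod M\<close> is 0, makes the closing of
  the cycle an instance.\<close>

lemma run_take_shifted_transitions:
  assumes C: "G_up k M C" and "t \<le> M"
  shows "run (take t (shifted_transitions s k C)) (shift_perm s (C ! 0)) = shift_perm s (C ! (t mod M))"
  using assms(2)
proof (induction t)
  case (Suc t)
  let ?j = "transition_sequence k C ! t"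
  have len: "length C = M" using C by (simp add: G_up_def)
  have j: "0 < ?j" "C ! (Suc t mod M) = push 1 ?j (C ! t)"
    using transition_sequence_nth[OF C, of t] Suc.prems by auto
  have "run (take (Suc t) (shifted_transitions s k C)) (shift_perm s (C ! 0))
      = push (Suc s) (s + ?j) (shift_perm s (C ! t))"
    using Suc len by (simp add: take_Suc_conv_app_nth shifted_transitions_def length_transition_sequence)
  also have "\<dots> = shift_perm s (C ! (Suc t mod M))"
    using j by (simp only: push_shift_perm)
  finally show ?case .
qed simp

lemma run_shifted_transitions:
  assumes "G_up k M C"
  shows "run (shifted_transitions s k C) (shift_perm s (C ! 0)) = shift_perm s (C ! 0)"
  using run_take_shifted_transitions[OF assms order_refl, of s] assms
  by (simp add: G_up_def shifted_transitions_def length_transition_sequence)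

lemma visits_shifted_transitions:
  assumes "G_up k M C"
  shows "visits (shifted_transitions s k C) (shift_perm s (C ! 0)) = shift_perm s ` set C"
proof -
  let ?T = "shifted_transitions s k C"
  have len: "length C = M" "length ?T = M"
    using assms by (auto simp: G_up_def shifted_transitions_def length_transition_sequence)
  have "visits ?T (shift_perm s (C ! 0)) = generated_code (shift_perm s (C ! 0)) ?T"
    using generated_code_eq_visits[OF run_shifted_transitions[OF assms]] by simp
  also have "\<dots> = (\<lambda>r. shift_perm s (C ! r)) ` {..<M}"
    unfolding generated_code_def len
    by (rule image_cong) (auto simp: run_take_shifted_transitions[OF assms])
  also have "\<dots> = shift_perm s ` set C"
    using len by (auto simp: set_conv_nth)
  finally show ?thesis .
qed

lemma card_shift_perm_code:
  assumes "G_up k M C"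
  shows "card (shift_perm s ` set C) = M"
proof -
  have "inj_on (shift_perm s) (set C)"
    using assms by (auto simp: G_up_def intro: inj_on_subset[OF inj_on_shift_perm[of s k]])
  then show ?thesis
    using assms by (simp add: card_image distinct_card G_up_def)
qed

section \<open>Cyclic sequences and the recursion step\<close>

text \<open>The invariant of the recursion. It is stated for the start \<open>id\<close>, since any
  other start only translates the visited words; the common origin \<open>q\<close> controls their
  support.\<close>

definition cyclic_from :: "nat \<Rightarrow> nat \<Rightarrow> (nat \<times> nat) list \<Rightarrow> bool" where
  "cyclic_from q N T \<longleftrightarrow> (\<forall>(i, j) \<in> set T. i = q \<and> q < j) \<and> run T id = id \<and> card (visits T id) = N"

lemma card_generated_code:
  assumes "cyclic_from q N T" "inj \<sigma>"
  shows "card (generated_code \<sigma> T) = N"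
proof -
  have "generated_code \<sigma> T = (\<circ>) \<sigma> ` visits T id"
    using generated_code_comp[of \<sigma> id T] generated_code_eq_visits[of T id] assms(1)
    by (simp add: cyclic_from_def)
  moreover have "inj ((\<circ>) \<sigma>)"
    using assms(2) by (rule fun.inj_map)
  ultimately show ?thesis
    using assms(1) card_image[OF inj_on_subset[OF _ subset_UNIV]] by (metis cyclic_from_def)
qed

text \<open>The code may start anywhere, so its first word is cancelled on the left to reach the
  start \<open>id\<close>. This supplies the base built from a complete code.\<close>

lemma cyclic_from_shifted_transitions:
  assumes "G_up k M C" "0 < M"
  shows "cyclic_from (Suc s) M (shifted_transitions s k C)"
proof -
  let ?T = "shifted_transitions s k C" and ?c = "shift_perm s (C ! 0)"
  have "C ! 0 permutes {1..k}"
    using assms by (auto simp: G_up_def)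
  then have inj: "inj ((\<circ>) ?c)"
    using shift_perm_permutes permutes_inj fun.inj_map by metis
  have "?c \<circ> run ?T id = ?c \<circ> id"
    using run_shifted_transitions[OF assms(1), of s] run_comp[of ?T ?c id] by simp
  then have "run ?T id = id"
    by (rule injD[OF inj])
  moreover have "(\<circ>) ?c ` visits ?T id = shift_perm s ` set C"
    using visits_shifted_transitions[OF assms(1), of s] visits_comp[of ?T ?c id] by simp
  then have "card (visits ?T id) = M"
    using card_shift_perm_code[OF assms(1), of s] card_image[OF inj_on_subset[OF inj subset_UNIV]] by metis
  ultimately show ?thesis
    using shifted_transitions_mem[OF assms(1)] by (auto simp: cyclic_from_def)
qed

text \<open>The base for \<open>d < n < 2d\<close>: this push is a 3-cycle, and the entry at
  position \<open>p\<close> tells its three powers apart.\<close>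

lemma cyclic_from_rotation: "cyclic_from p 3 (replicate 3 (p, p + 2))"
proof -
  let ?f = "push p (p + 2)"
  have f3: "?f (?f (?f id)) = id"
    by (rule ext) (auto simp: push_def)
  have "?f (?f (?f id)) p = p" "?f id p = p + 2" "?f (?f id) p = p + 1"
    by (auto simp: push_def)
  then have "distinct [?f id, ?f (?f id), ?f (?f (?f id))]"
    by (auto dest: fun_cong[of _ _ p] simp del: id_apply)
  then have "card {?f id, ?f (?f id), ?f (?f (?f id))} = 3"
    using distinct_card by fastforce
  then show ?thesis
    using f3 by (auto simp: cyclic_from_def numeral_3_eq_3)
qed

text \<open>With \<open>q = Suc s + (k - 1) = s + k\<close>, the head of \<open>U\<close> is the
  push from \<open>q\<close> followed by the first auxiliary transition. So \<open>U\<close> acts as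
  that push followed by a whole auxiliary cycle, which closes; \<open>\<sigma>'\<close> itself is
  visited at the end of the block.\<close>

lemma block_sequence:
  fixes \<sigma> :: "nat \<Rightarrow> nat"
  assumes C: "G_up k M C" and "0 < M" "C ! 0 = id" "transition_sequence k C ! 0 = k" and "2 \<le> k"
    and "Suc s + (k - 1) < j"
  defines "U \<equiv> (Suc s, j) # map (\<lambda>i. (Suc s, s + i)) (tl (transition_sequence k C))"
    and "\<sigma>' \<equiv> push (Suc s + (k - 1)) j \<sigma>"
  shows "run U \<sigma> = \<sigma>'" "visits U \<sigma> = (\<lambda>a. \<sigma>' \<circ> a) ` shift_perm s ` set C"
proof -
  let ?S = "shifted_transitions s k C"
  have "transition_sequence k C \<noteq> []"
    using C \<open>0 < M\<close> length_transition_sequence[of k C] by (auto simp: G_up_def)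
  then have S: "?S = (Suc s, s + k) # map (\<lambda>i. (Suc s, s + i)) (tl (transition_sequence k C))"
    using assms(4) by (cases "transition_sequence k C") (auto simp: shifted_transitions_def)
  have "push (Suc s) (s + k) \<sigma>' = push (Suc s) j \<sigma>"
    using push_push_push[of "Suc s" "Suc s + (k - 1)" j \<sigma>] assms(5,6) by (simp add: \<sigma>'_def)
  then have "run U \<sigma> = run ?S \<sigma>'" "visits U \<sigma> = visits ?S \<sigma>'"
    by (simp_all add: S U_def)
  then show "run U \<sigma> = \<sigma>'" "visits U \<sigma> = (\<lambda>a. \<sigma>' \<circ> a) ` shift_perm s ` set C"
    using run_shifted_transitions[OF C, of s] visits_shifted_transitions[OF C, of s]
      run_comp[of ?S \<sigma>' id] visits_comp[of ?S \<sigma>' id] assms(3)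
    by (simp_all add: shift_perm_id)
qed

text \<open>The quotient \<open>u\<close> of the left factors is also a quotient of the right
  factors. Its support therefore lies in both ranges, which share at most the point
  \<open>q\<close>, and a permutation of one point is the identity.\<close>

lemma comp_perms_inj:
  fixes q :: nat
  assumes c: "c permutes {q..}" "c' permutes {q..}" and a: "a permutes {p..q}" "a' permutes {p..q}"
    and eq: "c \<circ> a = c' \<circ> a'"
  shows "c = c' \<and> a = a'"
proof -
  define u where "u = inv c' \<circ> c"
  have "u \<circ> a = inv c' \<circ> (c' \<circ> a')"
    by (simp add: u_def comp_assoc eq)
  also have "\<dots> = a'"
    using permutes_inv_o(2)[OF c(2)] by (simp add: comp_assoc[symmetric])
  finally have ua: "u \<circ> a = a'" .
  then have "u = a' \<circ> inv a"
    using permutes_inv_o(1)[OF a(1)] by (metis comp_assoc comp_id)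
  then have "u permutes {p..q}"
    using a by (simp add: permutes_compose permutes_inv)
  moreover have uq: "u permutes {q..}"
    using c by (simp add: u_def permutes_compose permutes_inv)
  ultimately have "\<forall>x. x \<notin> {q} \<longrightarrow> u x = x"
    by (metis atLeastAtMost_iff atLeast_iff le_antisym permutes_not_in singleton_iff)
  then have "u permutes {q}"
    using permutes_superset[OF uq, of "{q}"] by auto
  then have "u = id" by simp
  then have "a = a'" and "c' \<circ> u = c'" using ua by auto
  moreover have "c' \<circ> u = c"
    using permutes_inv_o(1)[OF c(2)] by (simp add: u_def comp_assoc[symmetric])
  ultimately show ?thesis by simp
qed

text \<open>Each block acts as the transition it replaces, so the run stays closed; the visited
  words are the products of old words with shifted auxiliary words, and
  \<open>comp_perms_inj\<close> makes the count multiplicative.\<close>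

lemma cyclic_from_step:
  fixes s k :: nat
  assumes T: "cyclic_from (Suc s + (k - 1)) N T"
    and C: "G_up k M C" and "0 < M" "C ! 0 = id" "transition_sequence k C ! 0 = k" and "2 \<le> k"
  defines "B \<equiv> \<lambda>(_ :: nat, j). (Suc s, j) # map (\<lambda>i. (Suc s, s + i)) (tl (transition_sequence k C))"
  shows "cyclic_from (Suc s) (N * M) (concat (map B T))"
proof -
  let ?q = "Suc s + (k - 1)" and ?D = "shift_perm s ` set C"
  have T': "\<forall>(i, j) \<in> set T. i = ?q \<and> ?q < j" "run T id = id" "card (visits T id) = N"
    using T by (auto simp: cyclic_from_def)
  \<comment> \<open>The start must be arbitrary, as each transition of \<open>T\<close> changes it
    in the induction.\<close>
  have steps: "run (concat (map B T)) \<sigma> = run T \<sigma> \<and>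
      visits (concat (map B T)) \<sigma> = (\<lambda>(c, a). c \<circ> a) ` (visits T \<sigma> \<times> ?D)" for \<sigma>
    using T'(1)
  proof (induction T \<sigma> rule: visits.induct)
    case (2 i j T \<sigma>)
    then have ij: "i = ?q" "?q < j" by auto
    have T: "\<forall>(i, j) \<in> set T. i = ?q \<and> ?q < j"
      using 2 by simp
    have IH: "run (concat (map B T)) (push i j \<sigma>) = run T (push i j \<sigma>)"
      "visits (concat (map B T)) (push i j \<sigma>) = (\<lambda>(c, a). c \<circ> a) ` (visits T (push i j \<sigma>) \<times> ?D)"
      by (rule conjunct1[OF "2.IH"[OF T]], rule conjunct2[OF "2.IH"[OF T]])
    have cons: "concat (map B ((i, j) # T)) = B (?q, j) @ concat (map B T)"
      by (simp add: ij B_def)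
    have U: "run (B (?q, j)) \<sigma> = push i j \<sigma>" "visits (B (?q, j)) \<sigma> = (\<lambda>a. push i j \<sigma> \<circ> a) ` ?D"
      unfolding B_def prod.case ij(1) by (rule block_sequence[OF C assms(3-6) ij(2)])+
    \<comment> \<open>The first block contributes the products with left factor
      \<open>push i j \<sigma>\<close>, the remaining blocks all others.\<close>
    have "visits (concat (map B ((i, j) # T))) \<sigma>
        = (\<lambda>a. push i j \<sigma> \<circ> a) ` ?D \<union> (\<lambda>(c, a). c \<circ> a) ` (visits T (push i j \<sigma>) \<times> ?D)"
      by (simp only: cons visits_append U IH)
    also have "\<dots> = (\<lambda>(c, a). c \<circ> a) ` (visits ((i, j) # T) \<sigma> \<times> ?D)"
    proof -
      have "(\<lambda>(x, y). f x y) ` (insert x V \<times> W) = f x ` W \<union> (\<lambda>(x, y). f x y) ` (V \<times> W)"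
        for f :: "(nat \<Rightarrow> nat) \<Rightarrow> (nat \<Rightarrow> nat) \<Rightarrow> nat \<Rightarrow> nat" and x V W
        by auto
      then show ?thesis by (simp only: visits.simps)
    qed
    finally have "visits (concat (map B ((i, j) # T))) \<sigma> = (\<lambda>(c, a). c \<circ> a) ` (visits ((i, j) # T) \<sigma> \<times> ?D)" .
    moreover have "run (concat (map B ((i, j) # T))) \<sigma> = run ((i, j) # T) \<sigma>"
      by (simp only: cons fold_append comp_apply U IH fold_simps prod.case)
    ultimately show ?case by (rule conjI[rotated])
  qed simp
  have inj: "inj_on (\<lambda>(c, a). c \<circ> a) (visits T id \<times> ?D)"
  proof (rule inj_onI, clarify)
    fix c f c' f'
    assume *: "c \<in> visits T id" "f \<in> set C" "c' \<in> visits T id" "f' \<in> set C"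
      "c \<circ> shift_perm s f = c' \<circ> shift_perm s f'"
    have "c permutes {?q..}" "c' permutes {?q..}"
      using visits_permutes[of T ?q id] T'(1) * permutes_id by blast+
    moreover have "shift_perm s f permutes {Suc s..?q}" "shift_perm s f' permutes {Suc s..?q}"
      using shift_perm_permutes[of _ k s] * C \<open>2 \<le> k\<close> by (auto simp: G_up_def)
    ultimately show "c = c' \<and> shift_perm s f = shift_perm s f'"
      using comp_perms_inj *(5) by blast
  qed
  have "i = Suc s \<and> Suc s < j" if ij: "(i, j) \<in> set (concat (map B T))" for i j
  proof -
    obtain j' where j': "?q < j'" "(i, j) \<in> set (B (?q, j'))"
      using ij T'(1) by (fastforce simp: B_def)
    moreover have "(i, j) \<in> set (shifted_transitions s k C)"
      if "(i, j) \<in> set (map (\<lambda>i. (Suc s, s + i)) (tl (transition_sequence k C)))"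
      using that by (cases "transition_sequence k C") (auto simp: shifted_transitions_def)
    ultimately show ?thesis
      using shifted_transitions_mem[OF C] by (auto simp: B_def)
  qed
  moreover have "card (visits (concat (map B T)) id) = N * M"
    using steps[of id] T'(3) card_image[OF inj] card_shift_perm_code[OF C, of s]
    by (simp add: card_cartesian_product)
  ultimately show ?thesis
    using steps[of id] T'(2) by (auto simp: cyclic_from_def)
qed

section \<open>The size of the construction\<close>

text \<open>For \<open>m\<close> in \<open>{1..d}\<close> the class is the progression
  \<open>m\<close>, \<open>m + d\<close>, \<open>m + 2 * d\<close>, ... cut off at \<open>n\<close>,
  so it suffices to count the admissible multipliers.\<close>

lemma card_residue_class:
  assumes "1 \<le> m" "m \<le> d"
  shows "card (residue_class n d m) = n div d + (if m \<le> n mod d then 1 else 0)"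
proof -
  let ?c = "n div d + (if m \<le> n mod d then 1 else 0)"
  have bound: "m + d * t \<le> n \<longleftrightarrow> t < ?c" for t
  proof -
    have n: "n = d * (n div d) + n mod d" by simp
    have r: "n mod d < d" using assms by simp
    \<comment> \<open>The remainder \<open>n mod d\<close> decides only the borderline case
      \<open>t = n div d\<close>.\<close>
    consider "t < n div d" | "t = n div d" | "Suc (n div d) \<le> t" by linarith
    then show ?thesis
    proof cases
      case 1
      then have "d * Suc t \<le> d * (n div d)" by (intro mult_le_mono2) simp
      then have "m + d * t \<le> d * (n div d)" using assms by simp
      with n 1 show ?thesis by linarith
    next
      case 2
      then have "m + d * t \<le> n \<longleftrightarrow> m \<le> n mod d" using n by (metis add.commute add_le_cancel_left)
      with 2 show ?thesis by auto
    next
      case 3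
      then have "d * Suc (n div d) \<le> d * t" by (intro mult_le_mono2)
      then have "d * (n div d) + d \<le> d * t" by simp
      then have "\<not> m + d * t \<le> n" using n r by linarith
      with 3 show ?thesis by simp
    qed
  qed
  have "residue_class n d m = (\<lambda>t. m + d * t) ` {..<?c}"
  proof (intro equalityI subsetI)
    fix x assume "x \<in> residue_class n d m"
    then have x: "1 \<le> x" "x \<le> n" "[x = m] (mod d)" by (auto simp: residue_class_def)
    \<comment> \<open>Otherwise \<open>d\<close> would divide \<open>m - x\<close>, which lies
      strictly between 0 and \<open>d\<close>.\<close>
    have "m \<le> x"
    proof (rule ccontr)
      assume "\<not> m \<le> x"
      then have "d dvd m - x"
        using x(3) by (simp add: cong_altdef_nat cong_sym_eq)
      then show False
        using \<open>\<not> m \<le> x\<close> x(1) assms by (auto dest: dvd_imp_le)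
    qed
    then obtain t where "x = m + d * t"
      using x(3) by (metis cong_altdef_nat dvdE le_add_diff_inverse)
    then show "x \<in> (\<lambda>t. m + d * t) ` {..<?c}"
      using x(2) bound by blast
  next
    fix x assume "x \<in> (\<lambda>t. m + d * t) ` {..<?c}"
    then obtain t where t: "x = m + d * t" "t < ?c" by blast
    with bound have "x \<le> n" by blast
    with t show "x \<in> residue_class n d m"
      using assms by (auto simp: residue_class_def cong_def)
  qed
  moreover have "inj_on (\<lambda>t. m + d * t) {..<?c}"
    using assms by (auto intro!: inj_onI)
  ultimately show ?thesis
    by (simp add: card_image)
qed

lemma class_start_Suc:
  "1 \<le> m \<Longrightarrow> class_start n d (Suc m) = class_start n d m + card (residue_class n d m)"
  by (simp add: class_start_def)

lemma M_tilde_pos: "3 \<le> k \<Longrightarrow> 0 < M_tilde k"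
  using fact_ge_self[of k] by (auto simp: M_tilde_def div_greater_zero_iff)

text \<open>\<open>fact k\<close> is even, so the division is exact; 5 is excluded because the value
  there is 57, not 60.\<close>

lemma M_tilde_odd: "3 \<le> k \<Longrightarrow> odd k \<Longrightarrow> k \<noteq> 5 \<Longrightarrow> real (M_tilde k) = fact k / 2"
proof -
  assume k: "3 \<le> k" "odd k" "k \<noteq> 5"
  have "even (fact k :: nat)"
    using k by (intro dvd_fact) auto
  then have "real (fact k div 2) = fact k / 2"
    by (simp add: real_of_nat_div)
  then show ?thesis using k by (auto simp: M_tilde_def)
qed

lemma M_tilde_eq_\<rho>: "real (M_tilde k) = \<rho> k * fact k / 2"
  by (simp add: \<rho>_def)

text \<open>Downward induction from the top level, each step contributing one factor through
  \<open>cyclic_from_step\<close>.\<close>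

lemma cyclic_from_construction:
  assumes "1 \<le> m" "m \<le> top_level n d" "1 \<le> d" "d < n"
    and aux: "\<And>k. 3 \<le> k \<Longrightarrow> G_aux k (M_tilde k) (A k)"
    and aux_start: "\<And>k. 3 \<le> k \<Longrightarrow> A k ! 0 = id"
    and aux_first: "\<And>k. 3 \<le> k \<Longrightarrow> transition_sequence k (A k) ! 0 = k"
    and base: "cyclic_from (class_start n d (top_level n d)) N (base_transitions n d B)"
  shows "cyclic_from (class_start n d m)
    (N * (\<Prod>i = m..<top_level n d. M_tilde (card (residue_class n d i) + 1)))
    (construction_transitions n d A B m)"
  using assms(2,1)
proof (induction m rule: inc_induct)
  case base
  then show ?case
    using assms(8) by (simp add: construction_transitions_def)
next
  case (step m)
  let ?c = "card (residue_class n d m)" and ?p = "class_start n d m" and ?t = "top_level n d"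
  have top: "?t \<le> d" "2 * d \<le> n \<or> ?t = n mod d"
    using assms(3) by (auto simp: top_level_def less_imp_le)
  \<comment> \<open>Auxiliary codes are given only from size 3 on. If \<open>n < 2 * d\<close>,
    levels below the top satisfy \<open>m < n mod d\<close>, so their classes have the extra
    element.\<close>
  have "2 \<le> ?c"
  proof (cases "2 * d \<le> n")
    case True
    then have "2 \<le> n div d" using assms(3) by (simp add: less_eq_div_iff_mult_less_eq)
    then show ?thesis using card_residue_class[of m d n] step top by simp
  next
    case False
    then have "m \<le> n mod d" "0 < n div d" using step top assms(3,4) by (auto simp: div_greater_zero_iff)
    then show ?thesis using card_residue_class[of m d n] step top by simp
  qed
  then have k: "3 \<le> ?c + 1" by simp
  have p: "?p = Suc (?p - 1)" by (simp add: class_start_def)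
  \<comment> \<open>The auxiliary block has one position more than class \<open>m\<close>, so its
    last position is the start of the next class.\<close>
  have q: "class_start n d (Suc m) = Suc (?p - 1) + (?c + 1 - 1)"
    using class_start_Suc[of m n d] step p by simp
  have A: "G_up (?c + 1) (M_tilde (?c + 1)) (A (?c + 1))"
    using aux[OF k] by (simp add: G_aux_def)
  let ?T = "construction_transitions n d A B (Suc m)"
    and ?N = "N * (\<Prod>i = Suc m..<?t. M_tilde (card (residue_class n d i) + 1))"
  have "cyclic_from (Suc (?p - 1) + (?c + 1 - 1)) ?N ?T"
    using step.IH by (simp add: q)
  then have "cyclic_from (Suc (?p - 1)) (?N * M_tilde (?c + 1))
      (concat (map (\<lambda>(_, j). (Suc (?p - 1), j) #
        map (\<lambda>i. (Suc (?p - 1), ?p - 1 + i)) (tl (transition_sequence (?c + 1) (A (?c + 1))))) ?T))"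
    using k by (intro cyclic_from_step A M_tilde_pos aux_start aux_first) auto
  moreover have "construction_transitions n d A B m = step_transitions n d A m ?T"
    using step.hyps by (simp add: construction_transitions_def upt_conv_Cons)
  moreover have "(\<Prod>i = m..<?t. M_tilde (card (residue_class n d i) + 1))
      = M_tilde (?c + 1) * (\<Prod>i = Suc m..<?t. M_tilde (card (residue_class n d i) + 1))"
    using step.hyps by (simp add: prod.atLeast_Suc_lessThan)
  ultimately show ?case
    unfolding step_transitions_def Let_def p[symmetric] by (simp add: mult_ac)
qed

text \<open>Classes up to \<open>r\<close> have \<open>F + 1\<close> elements, the later ones
  \<open>F\<close>. For \<open>F \<ge> 2\<close> the base on class \<open>d\<close>, which lies
  beyond \<open>r\<close>, gives \<open>fact F\<close>; for \<open>F = 1\<close> the base and each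
  of the \<open>r - 1\<close> steps give 3.\<close>

lemma card_construction_code:
  assumes d: "1 \<le> d" "d < n"
    and aux: "\<And>k. 3 \<le> k \<Longrightarrow> G_aux k (M_tilde k) (A k)"
    and aux_start: "\<And>k. 3 \<le> k \<Longrightarrow> A k ! 0 = id"
    and aux_first: "\<And>k. 3 \<le> k \<Longrightarrow> transition_sequence k (A k) ! 0 = k"
    and complete: "\<And>k. 2 \<le> k \<Longrightarrow> G_up k (fact k) (B k)"
    and start: "class_concatenation n d \<sigma>\<^sub>0"
  defines "F \<equiv> n div d" and "r \<equiv> n mod d" and "C\<^sub>1 \<equiv> construction_code n d A B \<sigma>\<^sub>0 1"
  shows "2 \<le> F \<Longrightarrow> card C\<^sub>1 = fact F * M_tilde (F + 2) ^ r * M_tilde (F + 1) ^ (d - 1 - r)"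
    and "F = 1 \<Longrightarrow> card C\<^sub>1 = 3 ^ r"
proof -
  let ?t = "top_level n d"
  have "inj \<sigma>\<^sub>0"
    using start by (auto simp: class_concatenation_def permutes_inj)
  then have card: "card C\<^sub>1 = N * (\<Prod>i = 1..<?t. M_tilde (card (residue_class n d i) + 1))"
    if "cyclic_from (class_start n d ?t) N (base_transitions n d B)" "1 \<le> ?t" for N
    unfolding C\<^sub>1_def construction_code_def
    by (intro card_generated_code[OF cyclic_from_construction] that d order_refl aux aux_start aux_first)
  have r: "r < d" using d by (simp add: r_def)
  have R: "card (residue_class n d i) = (if i \<le> r then F + 1 else F)" if "1 \<le> i" "i \<le> d" for i
    using card_residue_class[OF that, of n] by (simp add: F_def r_def)
  show "card C\<^sub>1 = fact F * M_tilde (F + 2) ^ r * M_tilde (F + 1) ^ (d - 1 - r)" if F: "2 \<le> F"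
  proof -
    have n: "2 * d \<le> n"
      using F d by (simp add: F_def less_eq_div_iff_mult_less_eq)
    then have t: "?t = d" by (simp add: top_level_def)
    have p: "Suc (class_start n d d - 1) = class_start n d d"
      by (simp add: class_start_def)
    have "base_transitions n d B = shifted_transitions (class_start n d d - 1) F (B F)"
      unfolding shifted_transitions_def p using n R[of d] r d
      by (simp add: base_transitions_def Let_def)
    then have "cyclic_from (class_start n d ?t) (fact F) (base_transitions n d B)"
      using cyclic_from_shifted_transitions[OF complete[OF F], of "class_start n d d - 1"] p t by simp
    then have "card C\<^sub>1 = fact F * (\<Prod>i = 1..<d. M_tilde (card (residue_class n d i) + 1))"
      using card t d by simp
    also have "(\<Prod>i = 1..<d. M_tilde (card (residue_class n d i) + 1))
        = (\<Prod>i = 1..<Suc r. M_tilde (card (residue_class n d i) + 1))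
          * (\<Prod>i = Suc r..<d. M_tilde (card (residue_class n d i) + 1))"
      by (rule prod.atLeastLessThan_concat[symmetric]) (use r in auto)
    also have "(\<Prod>i = 1..<Suc r. M_tilde (card (residue_class n d i) + 1)) = (\<Prod>i = 1..<Suc r. M_tilde (F + 2))"
      using R r by (intro prod.cong) auto
    also have "(\<Prod>i = Suc r..<d. M_tilde (card (residue_class n d i) + 1)) = (\<Prod>i = Suc r..<d. M_tilde (F + 1))"
      using R r by (intro prod.cong) auto
    finally show ?thesis by (simp add: mult_ac)
  qed
  show "card C\<^sub>1 = 3 ^ r" if F: "F = 1"
  proof -
    have n: "\<not> 2 * d \<le> n"
        using F d less_eq_div_iff_mult_less_eq[of d 2 n] by (simp add: F_def)
    then have t: "?t = r" by (simp add: top_level_def r_def)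
    \<comment> \<open>Here \<open>n = d + r\<close>, while \<open>d < n\<close>.\<close>
    have "r \<noteq> 0"
      using F d by (metis F_def div_mult_mod_eq add.right_neutral less_irrefl mult_1 r_def)
    have "(\<Sum>i = 1..<r. card (residue_class n d i)) = (\<Sum>i = 1..<r. 2)"
      using R r F by (intro sum.cong) auto
    \<comment> \<open>All \<open>r - 1\<close> earlier classes have two elements, so the base pair
      of the construction is a push across three positions from the start of class
      \<open>r\<close>.\<close>
    then have p: "class_start n d r = 2 * r - 1" "2 * r + 1 = class_start n d r + 2"
      using \<open>r \<noteq> 0\<close> by (auto simp: class_start_def)
    have "base_transitions n d B = replicate 3 (class_start n d r, class_start n d r + 2)"
      unfolding p(2)[symmetric] unfolding p(1) using n by (simp add: base_transitions_def Let_def r_def)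
    then have "card C\<^sub>1 = 3 * (\<Prod>i = 1..<r. M_tilde (card (residue_class n d i) + 1))"
      using card[of 3] t \<open>r \<noteq> 0\<close> cyclic_from_rotation by simp
    also have "(\<Prod>i = 1..<r. M_tilde (card (residue_class n d i) + 1)) = (\<Prod>i = 1..<r. 3)"
      using R r F by (intro prod.cong) (auto simp: M_tilde_def fact_numeral)
    finally show ?thesis
      using \<open>r \<noteq> 0\<close> by (simp add: power_eq_if)
  qed
qed

text \<open>Used with \<open>f = fact F\<close>, \<open>g = fact (F + 1)\<close>,
  \<open>m = F + 1\<close> and \<open>h = F + 2\<close>. Writing \<open>f\<close> as
  \<open>g / m\<close> supplies the last of the \<open>d\<close> factors \<open>g\<close>; one of
  \<open>x\<close>, \<open>y\<close> is 1 and the other a value of \<open>\<rho>\<close>.\<close>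

lemma size_product_eq:
  fixes f g h m x y :: real
  assumes "g = m * f" "m \<noteq> 0"
  shows "f * (x * (h * g) / 2) ^ r * (y * g / 2) ^ e = h ^ r * g ^ Suc (r + e) * (x ^ r * y ^ e / (2 ^ (r + e) * m))"
proof -
  have f: "f = g / m" using assms by simp
  have p: "g ^ Suc (r + e) = g * (g ^ r * g ^ e)" "(2::real) ^ (r + e) = 2 ^ r * 2 ^ e"
    by (simp_all add: power_add)
  show ?thesis
    unfolding f p power_mult_distrib power_divide by (simp, simp only: mult_ac)
qed

lemma ceiling_divide_nat:
  assumes "1 \<le> d" "n mod d \<noteq> 0"
  shows "nat \<lceil>real n / real d\<rceil> = n div d + 1"
proof -
  have "real n = real d * real (n div d) + real (n mod d)"
    by (metis mult_div_mod_eq of_nat_add of_nat_mult)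
  moreover have "n mod d < d" using assms by simp
  ultimately have "\<lceil>real n / real d\<rceil> = int (n div d) + 1"
    using assms by (intro ceiling_unique) (simp_all add: field_simps)
  then show ?thesis by simp
qed

theorem lemma19:
  fixes n d F K r :: nat
    and A B :: "nat \<Rightarrow> (nat \<Rightarrow> nat) list"
    and \<sigma>\<^sub>0 :: "nat \<Rightarrow> nat"
    and C\<^sub>1 :: "(nat \<Rightarrow> nat) set"
  assumes "1 \<le> d" and "d < n"
    and aux: "\<And>k. 3 \<le> k \<Longrightarrow> G_aux k (M_tilde k) (A k)"
    and aux_start: "\<And>k. 3 \<le> k \<Longrightarrow> A k ! 0 = id"
    and aux_first: "\<And>k. 3 \<le> k \<Longrightarrow> transition_sequence k (A k) ! 0 = k"
    and complete: "\<And>k. 2 \<le> k \<Longrightarrow> G_up k (fact k) (B k)"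
    and start: "class_concatenation n d \<sigma>\<^sub>0"
    and C\<^sub>1: "C\<^sub>1 = construction_code n d A B \<sigma>\<^sub>0 1"
    and F: "F = n div d"
    and K: "K = nat \<lceil>real n / real d\<rceil>"
    and r: "r = n mod d"
  shows
    "(F > 4 \<and> even F \<longrightarrow>
        real (card C\<^sub>1) = (real K + 1) ^ r * (fact (F + 1)) ^ d
          * (\<rho> (K + 1) ^ r / (2 ^ (d - 1) * (real F + 1)))) \<and>
     (F = 4 \<longrightarrow> real (card C\<^sub>1) = (178 / 57) ^ r * 57 ^ (d - 1) * 24) \<and>
     (F = 2 \<longrightarrow> real (card C\<^sub>1) = (8 / 3) ^ r * 3 ^ (d - 1) * 2) \<and>
     (F > 5 \<and> odd F \<longrightarrow>
        real (card C\<^sub>1) = (real K + 1) ^ r * (fact (F + 1)) ^ d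
          * (\<rho> (F + 1) ^ ((d - 1) - r) / (2 ^ (d - 1) * (real F + 1)))) \<and>
     (F = 5 \<longrightarrow> real (card C\<^sub>1) = (1260 / 89) ^ r * 178 ^ d * (120 / 178)) \<and>
     (F = 3 \<longrightarrow> real (card C\<^sub>1) = (57 / 8) ^ r * 8 ^ d * (3 / 4)) \<and>
     (F = 1 \<longrightarrow> real (card C\<^sub>1) = 3 ^ r)"
proof -
  have size: "card C\<^sub>1 = fact F * M_tilde (F + 2) ^ r * M_tilde (F + 1) ^ (d - 1 - r)" if "2 \<le> F"
    using card_construction_code(1)[OF assms(1,2) aux aux_start aux_first complete start] that
    unfolding C\<^sub>1 F r by blast
  have size1: "card C\<^sub>1 = 3 ^ r" if "F = 1"
    using card_construction_code(2)[OF assms(1,2) aux aux_start aux_first complete start] that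
    unfolding C\<^sub>1 F r by blast
  have rd: "r \<le> d - 1" using assms(1) r mod_less_divisor[of d n] by linarith
  then obtain e where e: "d = Suc (r + e)"
    using assms(1) by (metis Suc_diff_1 le_Suc_ex less_eq_Suc_le One_nat_def)
  \<comment> \<open>For \<open>r = 0\<close> the ceiling is \<open>F\<close>, but \<open>K\<close>
    enters the formulas only under the exponent \<open>r\<close>.\<close>
  have Kr: "K = F + 1" if "r \<noteq> 0"
    using ceiling_divide_nat[OF assms(1)] that K F r by simp
  have F2: "(fact (F + 2) :: real) = (real F + 2) * fact (F + 1)" "(fact (F + 1) :: real) = (real F + 1) * fact F"
    by (simp_all add: algebra_simps)
  show ?thesis
  proof (intro conjI impI)
    assume *: "F > 4 \<and> even F"
    \<comment> \<open>\<open>F + 1\<close> is odd and exceeds 5, so the density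
      \<open>\<rho>\<close> remains only at the even size \<open>F + 2\<close>.\<close>
    then have M: "real (M_tilde (F + 1)) = fact (F + 1) / 2"
      by (intro M_tilde_odd) auto
    have "real (card C\<^sub>1) = fact F * real (M_tilde (F + 2)) ^ r * real (M_tilde (F + 1)) ^ e"
      using size * e by simp
    also have "\<dots> = fact F * (\<rho> (F + 2) * fact (F + 2) / 2) ^ r * (fact (F + 1) / 2) ^ e"
      by (simp only: M M_tilde_eq_\<rho>[of "F + 2"])
    also have "\<dots> = (real F + 2) ^ r * fact (F + 1) ^ d * (\<rho> (F + 2) ^ r / (2 ^ (d - 1) * (real F + 1)))"
      using size_product_eq[of "fact (F + 1)" "real F + 1" "fact F" "\<rho> (F + 2)" "real F + 2" r 1 e] F2 e
      by (simp del: fact_Suc)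
    also have "\<dots> = (real K + 1) ^ r * fact (F + 1) ^ d * (\<rho> (K + 1) ^ r / (2 ^ (d - 1) * (real F + 1)))"
      using Kr by (cases "r = 0") (auto simp: add.commute)
    finally show "real (card C\<^sub>1) = (real K + 1) ^ r * fact (F + 1) ^ d * (\<rho> (K + 1) ^ r / (2 ^ (d - 1) * (real F + 1)))" .
  next
    assume *: "F > 5 \<and> odd F"
    \<comment> \<open>Now the odd size is \<open>F + 2\<close>, and \<open>\<rho>\<close> remains at
      \<open>F + 1\<close>.\<close>
    then have M: "real (M_tilde (F + 2)) = fact (F + 2) / 2"
      by (intro M_tilde_odd) auto
    have "real (card C\<^sub>1) = fact F * real (M_tilde (F + 2)) ^ r * real (M_tilde (F + 1)) ^ e"
      using size * e by simp
    also have "\<dots> = fact F * (fact (F + 2) / 2) ^ r * (\<rho> (F + 1) * fact (F + 1) / 2) ^ e"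
      by (simp only: M M_tilde_eq_\<rho>[of "F + 1"])
    also have "\<dots> = (real F + 2) ^ r * fact (F + 1) ^ d * (\<rho> (F + 1) ^ e / (2 ^ (d - 1) * (real F + 1)))"
      using size_product_eq[of "fact (F + 1)" "real F + 1" "fact F" 1 "real F + 2" r "\<rho> (F + 1)" e] F2 e
      by (simp del: fact_Suc)
    also have "\<dots> = (real K + 1) ^ r * fact (F + 1) ^ d * (\<rho> (F + 1) ^ ((d - 1) - r) / (2 ^ (d - 1) * (real F + 1)))"
      using Kr e by (cases "r = 0") (auto simp: add.commute)
    finally show "real (card C\<^sub>1) = (real K + 1) ^ r * fact (F + 1) ^ d * (\<rho> (F + 1) ^ ((d - 1) - r) / (2 ^ (d - 1) * (real F + 1)))" .
  next
    assume "F = 5"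
    \<comment> \<open>2520 is \<open>M_tilde 7\<close>, and 178 is \<open>M_tilde 6\<close>.\<close>
    moreover have "(1260 / 89) ^ r * 178 ^ r = (2520 :: real) ^ r"
      by (simp flip: power_mult_distrib)
    ultimately show "real (card C\<^sub>1) = (1260 / 89) ^ r * 178 ^ d * (120 / 178)"
      using size e by (simp add: M_tilde_def fact_numeral power_add mult.assoc[symmetric] del: power_divide)
  next
    assume "F = 1"
    then show "real (card C\<^sub>1) = 3 ^ r" using size1 by simp
  \<comment> \<open>The cases 4, 2 and 3 of \<open>F\<close> are numerical, from the values 3, 8, 57
    and 178 of \<open>M_tilde\<close> at 3, 4, 5 and 6.\<close>
  qed (use size e in \<open>simp_all add: M_tilde_def fact_numeral power_add power_divide\<close>)
qed

end
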